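(* Let $A$ and $A'$ be the adjacency matrices (on a common vertex set) of strongly regular graphs with parameters $(v,k,\lambda,\mu)$, with the property that $A+A'$ is a $0$-$1$ matrix or $A+A'+I$ is a $1$-$2$ matrix. Define $\lambda'$ to be $2\mu$ or $2\mu-1$ if $A+A'$ is a $0$-$1$ matrix, and $2\mu+1$ or $2\mu-2$ if $A+A'+I$ is a $1$-$2$ matrix. Then: (i) if $\mu=\lambda+1$ or $\mu=\lambda-1$, then $(\mathcal{V}_A,\mathcal{B}_A\cup\mathcal{B}_{A'})$ is a $2$-$(v,k,\lambda')$ adesign; (ii) if $\mu=\lambda+1$ or $\mu=\lambda+3$, then $(\mathcal{V}_A,\mathcal{B}_{A+I}\cup\mathcal{B}_{A'+I})$ is a $2$-$(v,k+1,\lambda')$ adesign.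
   Context: $J$ denotes the all-one matrix and $I$ the identity matrix. A strongly regular graph with parameters $(v,k,\lambda,\mu)$ is a graph on $v$ vertices, regular of degree $k$, in which any two adjacent vertices have exactly $\lambda$ common neighbours and any two distinct non-adjacent vertices have exactly $\mu$ common neighbours. A $1$-$2$ matrix is a matrix all of whose entries are $1$ or $2$. For a $0$-$1$ matrix $M$ with rows and columns indexed by the vertex set, $\mathcal{V}_M$ denotes the set indexing the columns and $\mathcal{B}_M$ the collection of supports of the rows of $M$ (one block per row); the union of two such collections is the collection of all $2v$ blocks. A $2$-$(v,k,\lambda)$ adesign is an incidence structure with $v$ points and all blocks of size $k$, in which every pair of distinct points lies in either $\lambda$ or $\lambda+1$ blocks for a positive integer $\lambda$, and which is not a $2$-design (i.e., not every pair lies in the same number of blocks).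
   Formalization: Assumes in addition that the graphs are neither edgeless nor complete, that μ>0, and that A+A' ≠ J−I (not complementary); in each excluded case the claim fails, e.g. C5 and its complement give a 2-design. λ' is one of the two listed values, chosen separately in each case. *)

theory Defs
  imports "HOL-Analysis.Analysis" "HOL-Library.Multiset"
begin

text \<open>Simple graphs have vertex set the finite type \<open>'n\<close> and are given by their adjacency
  relation.\<close>

definition simple_graph :: "('n \<Rightarrow> 'n \<Rightarrow> bool) \<Rightarrow> bool" where
  "simple_graph E \<longleftrightarrow> (\<forall>x y. E x y \<longrightarrow> E y x) \<and> (\<forall>x. \<not> E x x)"

text \<open>Complete and edgeless graphs are not excluded here: for them \<open>mu\<close>, respectively \<open>lam\<close>,
  is unconstrained.\<close>

definition strongly_regular ::
    "('n::finite \<Rightarrow> 'n \<Rightarrow> bool) \<Rightarrow> nat \<Rightarrow> nat \<Rightarrow> nat \<Rightarrow> nat \<Rightarrow> bool" where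
  "strongly_regular E v k lam mu \<longleftrightarrow>
     simple_graph E \<and>
     CARD('n) = v \<and>
     (\<forall>x. card {y. E x y} = k) \<and>
     (\<forall>x y. E x y \<longrightarrow> card {z. E x z \<and> E y z} = lam) \<and>
     (\<forall>x y. x \<noteq> y \<and> \<not> E x y \<longrightarrow> card {z. E x z \<and> E y z} = mu)"

definition adjacency_matrix :: "('n::finite \<Rightarrow> 'n \<Rightarrow> bool) \<Rightarrow> int ^ 'n ^ 'n" where
  "adjacency_matrix E = (\<chi> x y. if E x y then 1 else 0)"

definition all_one_matrix :: "int ^ 'n ^ 'n" where
  "all_one_matrix = (\<chi> x y. 1)"

definition zero_one_matrix :: "int ^ 'n ^ 'm \<Rightarrow> bool" where
  "zero_one_matrix M \<longleftrightarrow> (\<forall>i j. M $ i $ j \<in> {0, 1})"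

definition one_two_matrix :: "int ^ 'n ^ 'm \<Rightarrow> bool" where
  "one_two_matrix M \<longleftrightarrow> (\<forall>i j. M $ i $ j \<in> {1, 2})"

definition matrix_points :: "int ^ 'n ^ 'm \<Rightarrow> 'n set" where
  "matrix_points M = UNIV"

text \<open>The blocks form a multiset, one block per row, so that rows with equal support are
  counted separately.\<close>

definition matrix_blocks :: "int ^ 'n ^ 'm::finite \<Rightarrow> 'n set multiset" where
  "matrix_blocks M = image_mset (\<lambda>i. {j. M $ i $ j \<noteq> 0}) (mset_set UNIV)"

definition pair_degree :: "'p set multiset \<Rightarrow> 'p \<Rightarrow> 'p \<Rightarrow> nat" where
  "pair_degree B x y = size {# b \<in># B. x \<in> b \<and> y \<in> b #}"

definition block_structure :: "'p set \<Rightarrow> 'p set multiset \<Rightarrow> nat \<Rightarrow> nat \<Rightarrow> bool" where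
  "block_structure P B v k \<longleftrightarrow>
     finite P \<and> card P = v \<and> (\<forall>b \<in># B. b \<subseteq> P \<and> card b = k)"

text \<open>The index \<open>l\<close> may be 0 here, so that \<open>\<not> (\<exists>r. two_design P B v k r)\<close> below says that the
  pairs of points do not all lie in the same number of blocks.\<close>

definition two_design :: "'p set \<Rightarrow> 'p set multiset \<Rightarrow> nat \<Rightarrow> nat \<Rightarrow> nat \<Rightarrow> bool" where
  "two_design P B v k l \<longleftrightarrow>
     block_structure P B v k \<and>
     (\<forall>x \<in> P. \<forall>y \<in> P. x \<noteq> y \<longrightarrow> pair_degree B x y = l)"

definition two_adesign :: "'p set \<Rightarrow> 'p set multiset \<Rightarrow> nat \<Rightarrow> nat \<Rightarrow> nat \<Rightarrow> bool" where
  "two_adesign P B v k l \<longleftrightarrow>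
     block_structure P B v k \<and>
     l > 0 \<and>
     (\<forall>x \<in> P. \<forall>y \<in> P. x \<noteq> y \<longrightarrow> pair_degree B x y \<in> {l, l + 1}) \<and>
     \<not> (\<exists>r. two_design P B v k r)"

end

theory Submission
  imports Defs
begin

text \<open>A pair of distinct points lies in \<open>lam\<close> or \<open>mu\<close> rows of \<open>A\<close> (in \<open>lam + 2\<close> or \<open>mu\<close> rows of
  \<open>A + I\<close>) according to whether it is an edge, so only two of the three degrees \<open>2 mu\<close>, \<open>a + mu\<close>,
  \<open>2 a\<close> with \<open>a = lam\<close> or \<open>a = lam + 2\<close> occur when the two graphs have disjoint or covering
  edge sets, and these differ by one. The smaller degree could vanish only for two covering graphs
  with \<open>lam = 0\<close> and \<open>mu = 1\<close>; these are necessarily complementary.\<close>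

lemma pair_degree_union:
  "pair_degree (B + B') x y = pair_degree B x y + pair_degree B' x y"
  by (simp add: pair_degree_def)

lemma pair_degree_matrix_blocks:
  "pair_degree (matrix_blocks M) x y = card {i. M $ i $ x \<noteq> 0 \<and> M $ i $ y \<noteq> 0}"
  by (simp add: pair_degree_def matrix_blocks_def filter_mset_image_mset)

lemma block_structure_matrix_blocks_union:
  assumes "CARD('n::finite) = v"
    and "\<And>i. card {j. (M :: int ^ 'n ^ 'n) $ i $ j \<noteq> 0} = k"
    and "\<And>i. card {j. (M' :: int ^ 'n ^ 'n) $ i $ j \<noteq> 0} = k"
  shows "block_structure UNIV (matrix_blocks M + matrix_blocks M') v k"
  using assms by (auto simp: block_structure_def matrix_blocks_def)

text \<open>Two pairs of points with different degrees refute \<open>two_design P B v k r\<close>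
  for every \<open>r\<close> at once.\<close>

lemma two_adesignI:
  assumes "block_structure P B v k" and "0 < l"
    and "\<And>x y. x \<in> P \<Longrightarrow> y \<in> P \<Longrightarrow> x \<noteq> y \<Longrightarrow> pair_degree B x y \<in> {l, l + 1}"
    and "x \<in> P" "y \<in> P" "x \<noteq> y" and "x' \<in> P" "y' \<in> P" "x' \<noteq> y'"
    and "pair_degree B x y \<noteq> pair_degree B x' y'"
  shows "two_adesign P B v k l"
  using assms unfolding two_adesign_def two_design_def by metis

lemma simple_graph_sym: "simple_graph E \<Longrightarrow> E x y \<longleftrightarrow> E y x"
  unfolding simple_graph_def by blast

lemma simple_graph_irrefl: "simple_graph E \<Longrightarrow> \<not> E x x"
  unfolding simple_graph_def by blast

lemma strongly_regular_simple: "strongly_regular E v k lam mu \<Longrightarrow> simple_graph E"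
  by (simp add: strongly_regular_def)

lemma strongly_regular_card: "strongly_regular (E :: 'n::finite \<Rightarrow> _) v k lam mu \<Longrightarrow> CARD('n) = v"
  by (simp add: strongly_regular_def)

lemma strongly_regular_degree: "strongly_regular E v k lam mu \<Longrightarrow> card {y. E x y} = k"
  by (simp add: strongly_regular_def)

lemma strongly_regular_common_neighbours:
  assumes "strongly_regular E v k lam mu" "x \<noteq> y"
  shows "card {z. E x z \<and> E y z} = (if E x y then lam else mu)"
  using assms by (simp add: strongly_regular_def)

lemma strongly_regular_closed_degree:
  assumes "strongly_regular E v k lam mu"
  shows "card {y. E x y \<or> x = y} = k + 1"
proof -
  have "{y. E x y \<or> x = y} = insert x {y. E x y}" by auto
  then show ?thesis
    using strongly_regular_degree[OF assms, of x]
      simple_graph_irrefl[OF strongly_regular_simple[OF assms], of x] by simp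
qed

text \<open>Closed neighbourhoods of adjacent vertices also share these two vertices, which adds 2
  to \<open>lam\<close>; for non-adjacent vertices nothing is added.\<close>

lemma strongly_regular_closed_common_neighbours:
  assumes srg: "strongly_regular E v k lam mu" and "x \<noteq> y"
  shows "card {z. (E x z \<or> x = z) \<and> (E y z \<or> y = z)} = (if E x y then lam + 2 else mu)"
proof -
  note simple = strongly_regular_simple[OF srg]
  have "{z. (E x z \<or> x = z) \<and> (E y z \<or> y = z)} =
      (if E x y then insert x (insert y {z. E x z \<and> E y z}) else {z. E x z \<and> E y z})"
    using \<open>x \<noteq> y\<close> simple_graph_sym[OF simple] by auto
  then show ?thesis
    using strongly_regular_common_neighbours[OF srg \<open>x \<noteq> y\<close>] \<open>x \<noteq> y\<close> simple_graph_irrefl[OF simple]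
    by auto
qed

lemma pair_degree_adjacency:
  assumes srg: "strongly_regular E v k lam mu" and "x \<noteq> y"
  shows "pair_degree (matrix_blocks (adjacency_matrix E)) x y = (if E x y then lam else mu)"
proof -
  \<comment> \<open>Symmetry of \<open>E\<close> turns the rows meeting both columns
    \<open>x\<close> and \<open>y\<close> into common neighbours.\<close>
  have "{i. adjacency_matrix E $ i $ x \<noteq> 0 \<and> adjacency_matrix E $ i $ y \<noteq> 0} = {z. E x z \<and> E y z}"
    using simple_graph_sym[OF strongly_regular_simple[OF srg]] by (auto simp: adjacency_matrix_def)
  then show ?thesis
    using strongly_regular_common_neighbours[OF assms] by (simp add: pair_degree_matrix_blocks)
qed

lemma adjacency_matrix_plus_mat_nonzero:
  "(adjacency_matrix E + mat 1) $ i $ j \<noteq> 0 \<longleftrightarrow> E i j \<or> i = j"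
  by (simp add: adjacency_matrix_def mat_def)

lemma pair_degree_closed_adjacency:
  assumes srg: "strongly_regular E v k lam mu" and "x \<noteq> y"
  shows "pair_degree (matrix_blocks (adjacency_matrix E + mat 1)) x y =
    (if E x y then lam + 2 else mu)"
proof -
  have "{i. (E i x \<or> i = x) \<and> (E i y \<or> i = y)} = {z. (E x z \<or> x = z) \<and> (E y z \<or> y = z)}"
    using simple_graph_sym[OF strongly_regular_simple[OF srg]] by auto
  then show ?thesis
    using strongly_regular_closed_common_neighbours[OF assms]
    by (simp only: pair_degree_matrix_blocks adjacency_matrix_plus_mat_nonzero)
qed

lemma zero_one_adjacency_sum:
  "zero_one_matrix (adjacency_matrix E + adjacency_matrix E') \<longleftrightarrow> (\<forall>x y. \<not> (E x y \<and> E' x y))"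
  by (auto simp: zero_one_matrix_def adjacency_matrix_def)

text \<open>Without loops the diagonal of the sum is 1. Off the diagonal an entry counts the graphs
  containing that edge, so it is at most 2 and only the value 0 has to be excluded.\<close>

lemma one_two_adjacency_sum:
  assumes "simple_graph E" "simple_graph E'"
  shows "one_two_matrix (adjacency_matrix E + adjacency_matrix E' + mat 1) \<longleftrightarrow>
    (\<forall>x y. x \<noteq> y \<longrightarrow> E x y \<or> E' x y)"
  using assms
  by (auto simp: one_two_matrix_def adjacency_matrix_def mat_def simple_graph_def)

lemma complementary_adjacency_sum:
  assumes "simple_graph E" "simple_graph E'"
  shows "adjacency_matrix E + adjacency_matrix E' = all_one_matrix - mat 1 \<longleftrightarrow>
    (\<forall>x y. x \<noteq> y \<longrightarrow> E x y \<noteq> E' x y)"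
  using assms
  by (auto simp: vec_eq_iff adjacency_matrix_def all_one_matrix_def mat_def simple_graph_def)

text \<open>An edge \<open>x y\<close> common to both triangle-free graphs forces every other vertex to be adjacent
  in \<open>E\<close> to \<open>x\<close> or \<open>y\<close>, which closes a 4-cycle in \<open>E\<close>, against \<open>mu = 1\<close>.\<close>
lemma covering_moore_graphs_edge_disjoint:
  fixes E E' :: "'n::finite \<Rightarrow> 'n \<Rightarrow> bool"
  assumes srg: "strongly_regular E v k 0 1" and srg': "strongly_regular E' v k 0 1"
    and "0 < k" and "k < v - 1"
    and cover: "\<And>x y. x \<noteq> y \<Longrightarrow> E x y \<or> E' x y"
  shows "\<not> (E x y \<and> E' x y)"
proof
  assume xy: "E x y \<and> E' x y"
  note sym = simple_graph_sym[OF strongly_regular_simple[OF srg]]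
  note irrefl = simple_graph_irrefl[OF strongly_regular_simple[OF srg]]
  have tri: "\<not> (E a c \<and> E b c)" if "E a b" for a b c
    using strongly_regular_common_neighbours[OF srg, of a b] that irrefl[of a] by fastforce
  have tri': "\<not> (E' a c \<and> E' b c)" if "E' a b" for a b c
    using strongly_regular_common_neighbours[OF srg', of a b] that
      simple_graph_irrefl[OF strongly_regular_simple[OF srg'], of a] by fastforce
  \<comment> \<open>Otherwise covering puts both \<open>x z\<close> and \<open>y z\<close> into
    \<open>E'\<close>, and they form a triangle of \<open>E'\<close> with
    \<open>x y\<close>.\<close>
  have dich: "E x z \<or> E y z" if "z \<noteq> x" "z \<noteq> y" for z
    using cover[of x z] cover[of y z] that tri'[of x y z] xy by blast
  have "\<not> UNIV \<subseteq> {x, y}"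
  proof
    assume "UNIV \<subseteq> {x, y}"
    then have "CARD('n) \<le> card {x, y}" by (intro card_mono) auto
    also have "\<dots> \<le> 2" by (simp add: card_insert_if)
    finally show False
      using strongly_regular_card[OF srg] \<open>0 < k\<close> \<open>k < v - 1\<close> by linarith
  qed
  then obtain z where z: "z \<noteq> x" "z \<noteq> y" by auto
  have two: "2 \<le> k" if "E a b" "E a c" "b \<noteq> c" for a b c
    using card_mono[of "{z. E a z}" "{b, c}"] that strongly_regular_degree[OF srg, of a] by auto
  \<comment> \<open>A third vertex gives \<open>x\<close> or \<open>y\<close> a second neighbour,
    and regularity carries this to all vertices.\<close>
  have "2 \<le> k" using dich[OF z] two[of x y z] two[of y x z] z xy sym by auto
  then have other: "\<exists>c. c \<noteq> b \<and> E a c" for a b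
  proof -
    have "\<not> {z. E a z} \<subseteq> {b}"
      using card_mono[of "{b}" "{z. E a z}"] \<open>2 \<le> k\<close> strongly_regular_degree[OF srg, of a] by auto
    then show ?thesis by auto
  qed
  \<comment> \<open>The edge \<open>y x\<close> is prolonged to a path \<open>y\<close>,
    \<open>x\<close>, \<open>p\<close>, \<open>q\<close> of \<open>E\<close>. Triangle-freeness
    separates \<open>q\<close> from \<open>x\<close>, so \<open>dich\<close> closes the path to a
    4-cycle, and the non-adjacent \<open>x\<close> and \<open>q\<close> share both \<open>y\<close>
    and \<open>p\<close>.\<close>
  obtain p where p: "p \<noteq> y" "E x p" using other by blast
  obtain q where q: "q \<noteq> x" "E p q" using other by blast
  have nxq: "\<not> E x q" using tri[of x p q] p q by blast
  have "q \<noteq> y" using tri[of x p y] p q xy by blast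
  then have "E q y" using dich[of q] q nxq sym by blast
  moreover have "E q p" using q sym by blast
  ultimately have "card {y, p} \<le> card {z. E x z \<and> E q z}"
    using p xy by (intro card_mono) auto
  then show False
    using strongly_regular_common_neighbours[OF srg, of x q] q nxq p by auto
qed

text \<open>The parameter \<open>a\<close> stands for \<open>lam\<close> with open neighbourhoods
  and for \<open>lam + 2\<close> with closed ones, so that both parts of the theorem are instances.
  The pair \<open>t u\<close> lies in both graphs or in neither, which keeps the disjoint and the
  covering case apart.\<close>

lemma two_adesign_of_edge_degrees:
  fixes E E' :: "'n::finite \<Rightarrow> 'n \<Rightarrow> bool"
  assumes bs: "block_structure UNIV (B + B') v k"
    and deg: "\<And>x y. x \<noteq> y \<Longrightarrow> pair_degree B x y = (if E x y then a else mu)"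
    and deg': "\<And>x y. x \<noteq> y \<Longrightarrow> pair_degree B' x y = (if E' x y then a else mu)"
    and disjoint_or_cover: "(\<forall>x y. \<not> (E x y \<and> E' x y)) \<or> (\<forall>x y. x \<noteq> y \<longrightarrow> E x y \<or> E' x y)"
    and edge: "p \<noteq> q" "E p q" and nonedge: "r \<noteq> s" "\<not> E r s" and same: "t \<noteq> u" "E t u = E' t u"
    and "0 < mu" and a: "mu = a + 1 \<or> a = mu + 1"
    and pos: "mu = a + 1 \<Longrightarrow> (\<forall>x y. x \<noteq> y \<longrightarrow> E x y \<or> E' x y) \<Longrightarrow> 0 < a"
  shows "\<exists>l. ((\<forall>x y. \<not> (E x y \<and> E' x y)) \<longrightarrow> l = 2 * mu \<or> l = 2 * mu - 1) \<and>
    ((\<forall>x y. x \<noteq> y \<longrightarrow> E x y \<or> E' x y) \<longrightarrow> l = 2 * mu + 1 \<or> l = 2 * mu - 2) \<and>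
    two_adesign UNIV (B + B') v k l"
proof -
  let ?disj = "\<forall>x y. \<not> (E x y \<and> E' x y)" and ?cover = "\<forall>x y. x \<noteq> y \<longrightarrow> E x y \<or> E' x y"
  have D: "pair_degree (B + B') x y = (if E x y then a else mu) + (if E' x y then a else mu)"
    if "x \<noteq> y" for x y using deg[OF that] deg'[OF that] by (simp add: pair_degree_union)
  show ?thesis
  proof (cases ?disj)
    case True
    then have not_cover: "\<not> ?cover" using same by blast
    \<comment> \<open>The smaller of \<open>a + mu\<close>, attained at the edge \<open>p q\<close>,
      and \<open>2 * mu\<close>, attained at \<open>t u\<close>, which lies in neither
      graph.\<close>
    define l where "l = (if mu = a + 1 then 2 * mu - 1 else 2 * mu)"
    have "two_adesign UNIV (B + B') v k l"
    proof (rule two_adesignI[OF bs _ _ _ _ \<open>p \<noteq> q\<close> _ _ \<open>t \<noteq> u\<close>])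
      show "0 < l" using \<open>0 < mu\<close> by (simp add: l_def)
      show "pair_degree (B + B') x y \<in> {l, l + 1}" if "x \<noteq> y" for x y
        using True a \<open>0 < mu\<close> by (auto simp: D[OF that] l_def)
      show "pair_degree (B + B') p q \<noteq> pair_degree (B + B') t u"
        using True a edge same by (auto simp: D)
    qed auto
    then show ?thesis using not_cover by (intro exI[of _ l]) (auto simp: l_def)
  next
    case False
    then have cover: ?cover using disjoint_or_cover by blast
    \<comment> \<open>The smaller of \<open>a + mu\<close>, attained at the non-edge
      \<open>r s\<close> of \<open>E\<close>, and \<open>2 * a\<close>, attained at
      \<open>t u\<close>, which lies in both graphs. Positivity is in doubt only when
      \<open>l\<close> is \<open>2 * mu - 2\<close>, that is \<open>2 * a\<close>.\<close>
    define l where "l = (if mu = a + 1 then 2 * mu - 2 else 2 * mu + 1)"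
    have "two_adesign UNIV (B + B') v k l"
    proof (rule two_adesignI[OF bs _ _ _ _ \<open>r \<noteq> s\<close> _ _ \<open>t \<noteq> u\<close>])
      show "0 < l" using pos cover by (simp add: l_def)
      show "pair_degree (B + B') x y \<in> {l, l + 1}" if "x \<noteq> y" for x y
        using cover that a by (auto simp: D[OF that] l_def)
      show "pair_degree (B + B') r s \<noteq> pair_degree (B + B') t u"
        using cover a nonedge same by (auto simp: D)
    qed auto
    then show ?thesis using False by (intro exI[of _ l]) (auto simp: l_def)
  qed
qed

theorem theorem3:
  fixes E E' :: "'n::finite \<Rightarrow> 'n \<Rightarrow> bool"
    and A A' :: "int ^ 'n ^ 'n"
    and v k lam mu :: nat
  assumes srg: "strongly_regular E v k lam mu"
    and srg': "strongly_regular E' v k lam mu"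
    and A: "A = adjacency_matrix E"
    and A': "A' = adjacency_matrix E'"
    and sum: "zero_one_matrix (A + A') \<or> one_two_matrix (A + A' + mat 1)"
    and not_edgeless: "0 < k"
    and not_complete: "k < v - 1"
    and mu_pos: "0 < mu"
    and not_complementary: "A + A' \<noteq> all_one_matrix - mat 1"
  shows
    "(mu = lam + 1 \<or> lam = mu + 1 \<longrightarrow>
        (\<exists>lam'. (zero_one_matrix (A + A') \<longrightarrow> lam' = 2 * mu \<or> lam' = 2 * mu - 1) \<and>
           (one_two_matrix (A + A' + mat 1) \<longrightarrow> lam' = 2 * mu + 1 \<or> lam' = 2 * mu - 2) \<and>
           two_adesign (matrix_points A) (matrix_blocks A + matrix_blocks A') v k lam'))
     \<and>
     (mu = lam + 1 \<or> mu = lam + 3 \<longrightarrow>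
        (\<exists>lam'. (zero_one_matrix (A + A') \<longrightarrow> lam' = 2 * mu \<or> lam' = 2 * mu - 1) \<and>
           (one_two_matrix (A + A' + mat 1) \<longrightarrow> lam' = 2 * mu + 1 \<or> lam' = 2 * mu - 2) \<and>
           two_adesign (matrix_points A)
             (matrix_blocks (A + mat 1) + matrix_blocks (A' + mat 1)) v (k + 1) lam'))"
proof -
  note simple = strongly_regular_simple[OF srg] strongly_regular_simple[OF srg']
  note disj_iff = zero_one_adjacency_sum[of E E', folded A A']
  note cover_iff = one_two_adjacency_sum[OF simple, folded A A']
  obtain p q where edge: "p \<noteq> q" "E p q"
  proof -
    fix x :: 'n
    have "0 < card {y. E x y}" using strongly_regular_degree[OF srg, of x] not_edgeless by simp
    then obtain y where "E x y" unfolding card_gt_0_iff by auto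
    moreover from this have "x \<noteq> y" using simple_graph_irrefl[OF simple(1), of x] by auto
    ultimately show thesis using that by simp
  qed
  obtain r s where nonedge: "r \<noteq> s" "\<not> E r s"
  proof -
    fix x :: 'n
    \<comment> \<open>A closed neighbourhood has \<open>k + 1 < v\<close> vertices.\<close>
    have "\<exists>y. \<not> (E x y \<or> x = y)"
    proof (rule ccontr)
      assume "\<nexists>y. \<not> (E x y \<or> x = y)"
      then have "{y. E x y \<or> x = y} = UNIV" by blast
      then show False
        using strongly_regular_closed_degree[OF srg, of x] strongly_regular_card[OF srg] not_complete
        by simp
    qed
    then show thesis using that by blast
  qed
  obtain t u where same: "t \<noteq> u" "E t u = E' t u"
    using not_complementary complementary_adjacency_sum[OF simple] unfolding A A' by blast
  \<comment> \<open>If \<open>lam = 0\<close> then \<open>mu = 1\<close>, while covering puts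
    \<open>t u\<close> into both graphs, which are edge-disjoint in that case.\<close>
  have pos: "0 < lam" if "mu = lam + 1" "\<forall>x y. x \<noteq> y \<longrightarrow> E x y \<or> E' x y"
  proof (rule ccontr)
    assume "\<not> 0 < lam"
    then have "lam = 0" "mu = 1" using that(1) by auto
    then have "\<not> (E t u \<and> E' t u)"
      using covering_moore_graphs_edge_disjoint[of E v k E' t u] srg srg' not_edgeless not_complete
        that(2) by blast
    then show False using same that(2) by blast
  qed
  have bs: "block_structure UNIV (matrix_blocks A + matrix_blocks A') v k"
    using strongly_regular_degree[OF srg] strongly_regular_degree[OF srg']
    by (intro block_structure_matrix_blocks_union strongly_regular_card[OF srg])
      (simp_all add: A A' adjacency_matrix_def)
  have bs_closed:
    "block_structure UNIV (matrix_blocks (A + mat 1) + matrix_blocks (A' + mat 1)) v (k + 1)"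
    unfolding A A'
    by (intro block_structure_matrix_blocks_union strongly_regular_card[OF srg])
      (simp_all only: adjacency_matrix_plus_mat_nonzero strongly_regular_closed_degree[OF srg]
        strongly_regular_closed_degree[OF srg'])
  note adesign = two_adesign_of_edge_degrees[OF _ _ _ sum[unfolded disj_iff cover_iff] edge nonedge
    same mu_pos]
  show ?thesis
    unfolding matrix_points_def disj_iff cover_iff
  proof (intro conjI impI)
    assume "mu = lam + 1 \<or> lam = mu + 1"
    then show "\<exists>l. ((\<forall>x y. \<not> (E x y \<and> E' x y)) \<longrightarrow> l = 2 * mu \<or> l = 2 * mu - 1) \<and>
        ((\<forall>x y. x \<noteq> y \<longrightarrow> E x y \<or> E' x y) \<longrightarrow> l = 2 * mu + 1 \<or> l = 2 * mu - 2) \<and>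
        two_adesign UNIV (matrix_blocks A + matrix_blocks A') v k l"
      using pos pair_degree_adjacency[OF srg] pair_degree_adjacency[OF srg']
      by (intro adesign[OF bs, where a = lam]) (auto simp: A A')
  next
    \<comment> \<open>With \<open>a = lam + 2\<close> the alternatives read
      \<open>a = mu + 1\<close> and \<open>mu = a + 1\<close>, and \<open>a\<close> is positive by
      itself.\<close>
    assume "mu = lam + 1 \<or> mu = lam + 3"
    then show "\<exists>l. ((\<forall>x y. \<not> (E x y \<and> E' x y)) \<longrightarrow> l = 2 * mu \<or> l = 2 * mu - 1) \<and>
        ((\<forall>x y. x \<noteq> y \<longrightarrow> E x y \<or> E' x y) \<longrightarrow> l = 2 * mu + 1 \<or> l = 2 * mu - 2) \<and>
        two_adesign UNIV (matrix_blocks (A + mat 1) + matrix_blocks (A' + mat 1)) v (k + 1) l"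
      using pair_degree_closed_adjacency[OF srg] pair_degree_closed_adjacency[OF srg']
      by (intro adesign[OF bs_closed, where a = "lam + 2"]) (auto simp: A A')
  qed
qed

end
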